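(* Let $f$ be a positive integer-valued function on the positive integers satisfying $f(n)=o(n)$, and assume that $n$ is sufficiently large (in terms of $f$). If $G$ is an $n$-vertex $K_3$-free graph with minimum degree at least $\frac{1}{3}n-f(n)$ and chromatic number at least $10^{391}$, then $G$ admits a partition $V(G)=I_1\cup I_2\cup A$ such that $I_1,I_2$ are independent sets, $|I_1|\geq \frac{2}{3}n-9f(n)$, $|I_2|\geq\frac{n}{3}-24f(n)$, and the induced subgraph $G[A]$ admits a graph homomorphism to the Kneser graph $KG(\frac{1}{3}n-44f(n),97f(n))$.
   Context: All graphs are finite and simple. For positive integers $m,k$, the Kneser graph $KG(m,k)$ has as vertex set the collection of all $m$-element subsets of $[2m+k]=\{1,\dots,2m+k\}$, two vertices being adjacent if and only if the corresponding subsets are disjoint (this is the graph often denoted $KG(2m+k,m)$). A graph homomorphism $F\to F'$ is a vertex map sending every edge of $F$ to an edge of $F'$. Rounding convention: quantities such as $\frac13 n-44f(n)$, $\frac23n-9f(n)$, $\frac n3-24f(n)$ used as integer parameters or cardinalities are understood to be rounded to an integer by a floor or ceiling compatible with the surrounding statement (for instance, the first Kneser parameter may be taken to be $\lceil\frac13 n\rceil-44f(n)$). *)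

theory Defs
  imports
    "HOL-Library.Landau_Symbols"
    "Graph_Theory.Pair_Digraph"
    "Graph_Theory.Digraph_Component"
begin

text \<open>
  A finite simple graph is a \<open>pair_graph\<close>: finite, loop-free, and with a symmetric set of
  arcs, so that every undirected edge is present as two opposite arcs.  The notions below are stated
  for \<open>pre_digraph\<close>, because that is the type of an induced subgraph \<open>G \<restriction> A\<close>;
  a \<open>pair_graph\<close> is coerced to it by \<open>with_proj\<close>.
\<close>

definition triangle_free :: "('a, 'b) pre_digraph \<Rightarrow> bool" where
  "triangle_free G \<longleftrightarrow>
     \<not> (\<exists>x y z. x \<rightarrow>\<^bsub>G\<^esub> y \<and> y \<rightarrow>\<^bsub>G\<^esub> z \<and> z \<rightarrow>\<^bsub>G\<^esub> x)"

text \<open>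
  In a graph with symmetric arcs and no parallel arcs the out-degree is the number of neighbours.
  The value is unspecified for a graph without vertices.
\<close>

definition min_degree :: "('a, 'b) pre_digraph \<Rightarrow> nat" where
  "min_degree G = Min (out_degree G ` verts G)"

definition proper_coloring :: "('a, 'b) pre_digraph \<Rightarrow> nat \<Rightarrow> ('a \<Rightarrow> nat) \<Rightarrow> bool" where
  "proper_coloring G k c \<longleftrightarrow>
     c ` verts G \<subseteq> {..<k} \<and> (\<forall>u v. u \<rightarrow>\<^bsub>G\<^esub> v \<longrightarrow> c u \<noteq> c v)"

definition chromatic_number :: "('a, 'b) pre_digraph \<Rightarrow> nat" where
  "chromatic_number G = (LEAST k. \<exists>c. proper_coloring G k c)"

definition independent_set :: "('a, 'b) pre_digraph \<Rightarrow> 'a set \<Rightarrow> bool" where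
  "independent_set G I \<longleftrightarrow>
     I \<subseteq> verts G \<and> (\<forall>u\<in>I. \<forall>v\<in>I. \<not> u \<rightarrow>\<^bsub>G\<^esub> v)"

definition graph_hom ::
    "('a, 'b) pre_digraph \<Rightarrow> ('c, 'd) pre_digraph \<Rightarrow> ('a \<Rightarrow> 'c) \<Rightarrow> bool" where
  "graph_hom F H h \<longleftrightarrow>
     h ` verts F \<subseteq> verts H \<and> (\<forall>u v. u \<rightarrow>\<^bsub>F\<^esub> v \<longrightarrow> h u \<rightarrow>\<^bsub>H\<^esub> h v)"

text \<open>
  The parameters follow the convention that \<open>kneser_graph m k\<close> lives on the
  \<open>m\<close>-subsets of \<open>{1..2*m+k}\<close>; it is often denoted \<open>KG(2m+k, m)\<close>.
  Both parameters are meant to be positive: for \<open>m = 0\<close> the only vertex is the empty set, which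
  carries a loop.
\<close>

definition kneser_graph :: "nat \<Rightarrow> nat \<Rightarrow> nat set pair_pre_digraph" where
  "kneser_graph m k =
     (let V = {S. S \<subseteq> {1..2 * m + k} \<and> card S = m}
      in \<lparr> pverts = V, parcs = {(S, T). S \<in> V \<and> T \<in> V \<and> S \<inter> T = {}} \<rparr>)"

end

theory Submission
  imports Defs
begin

text \<open>
  To each vertex \<open>v\<close> belongs the vector of its codegrees with all vertices.  A random sample of
  1200 vertices estimates these vectors in the square norm, and the estimate depends only on which
  sample points are neighbours of \<open>v\<close>; so there are at most a constant times \<open>2 ^ 1200\<close> separated
  codegree vectors.  Colouring vertices by a nearby centre of a maximal separated family shows that,
  when the chromatic number is large, some edge \<open>vw\<close> has close codegree vectors.  Since
  codegrees with \<open>v\<close> vanish on \<open>N v\<close>, this leaves few edges between \<open>N v\<close> and \<open>N w\<close>, hence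
  an independent set of size at least about \<open>(2/3 - 1/10) n\<close>.

  Let \<open>I\<close> be a maximum independent set, of size \<open>2n/3 - t\<close>, and \<open>B\<close> its complement.  Every vertex
  of \<open>B\<close> has at most \<open>t + F\<close> neighbours in \<open>B\<close>, and those with fewer than \<open>t/2 - F\<close> are
  independent.  If \<open>t > 8F\<close>, three of the others with disjoint neighbourhoods in \<open>B\<close> have no
  common neighbour in \<open>I\<close>, which makes seven colours enough.  So \<open>t \<le> 8F\<close>; the
  vertices of \<open>B\<close> adjacent to more than half of \<open>I\<close> form the second independent set, and disjoint
  neighbourhoods in \<open>I\<close> give the homomorphism to the Kneser graph.
\<close>

section \<open>Second moment of sampling with repetition\<close>

lemma sample_moments:
  fixes V Y :: "'a set"
  assumes fin: "finite V" and Y: "Y \<subseteq> V"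
  defines "n \<equiv> real (card V)" and "y \<equiv> real (card Y)"
  defines "L \<equiv> \<lambda>M. {xs. set xs \<subseteq> V \<and> length xs = M}"
  defines "X \<equiv> \<lambda>xs. n * real (length (filter (\<lambda>z. z \<in> Y) xs)) - real (length xs) * y"
  shows "(\<Sum>xs\<in>L M. X xs) = 0"
    and "(\<Sum>xs\<in>L M. (X xs)\<^sup>2) = n ^ M * real M * y * (n - y)"
proof (induction M)
  case 0
  have "L 0 = {[]}" unfolding L_def by auto
  then show "(\<Sum>xs\<in>L 0. X xs) = 0"
    and "(\<Sum>xs\<in>L 0. (X xs)\<^sup>2) = n ^ 0 * real 0 * y * (n - y)"
    by (simp_all add: X_def)
next
  case (Suc M)
  \<comment> \<open>\<open>b z\<close> is the change of \<open>X\<close> when \<open>z\<close> is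
    drawn. It sums to zero over \<open>V\<close>, so the cross terms vanish and the second moments
    of the single draws add up.\<close>
  define b where "b z = (if z \<in> Y then n - y else - y)" for z
  have b0: "(\<Sum>z\<in>V. b z) = 0"
  proof -
    have "(\<Sum>z\<in>V. b z) = (\<Sum>z\<in>V. n * of_bool (z \<in> Y) - y)"
      by (rule sum.cong) (auto simp: b_def)
    also have "\<dots> = n * y - n * y"
      using fin Y by (simp add: sum_subtractf sum_distrib_left[symmetric] n_def y_def
          Int_absorb1 sum.If_cases of_bool_def)
    finally show ?thesis by simp
  qed
  have b2: "(\<Sum>z\<in>V. (b z)\<^sup>2) = n * y * (n - y)"
  proof -
    have "(\<Sum>z\<in>V. (b z)\<^sup>2) = (\<Sum>z\<in>V. (n * n - 2 * n * y) * of_bool (z \<in> Y) + y * y)"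
      by (rule sum.cong) (auto simp: b_def power2_eq_square algebra_simps)
    also have "\<dots> = (n * n - 2 * n * y) * y + n * (y * y)"
      using fin Y by (simp add: sum.distrib sum_distrib_left[symmetric] n_def y_def
          Int_absorb1 sum.If_cases of_bool_def)
    finally show ?thesis by (simp add: algebra_simps)
  qed
  have LS: "L (Suc M) = (\<lambda>(xs, z). z # xs) ` (L M \<times> V)"
    unfolding L_def by (rule lists_length_Suc_eq)
  have XS: "X (z # xs) = X xs + b z" for z xs
    by (simp add: X_def b_def algebra_simps)
  have card_L: "real (card (L M)) = n ^ M"
    unfolding L_def n_def using card_lists_length_eq[OF fin, of M] by simp
  have inj: "inj_on (\<lambda>(xs, z). z # xs) (L M \<times> V)"
    by (auto simp: inj_on_def)
  have s1: "(\<Sum>xs\<in>L (Suc M). g (X xs)) = (\<Sum>xs\<in>L M. \<Sum>z\<in>V. g (X xs + b z))" for g :: "real \<Rightarrow> real"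
    unfolding LS sum.reindex[OF inj] sum.cartesian_product by (intro sum.cong) (auto simp: XS)
  show "(\<Sum>xs\<in>L (Suc M). X xs) = 0"
    using s1[of "\<lambda>r. r"] Suc.IH(1) b0 by (simp add: sum.distrib sum_distrib_left[symmetric])
  have "(\<Sum>xs\<in>L (Suc M). (X xs)\<^sup>2) = (\<Sum>xs\<in>L M. \<Sum>z\<in>V. (X xs + b z)\<^sup>2)"
    by (rule s1)
  also have "\<dots> = (\<Sum>xs\<in>L M. n * (X xs)\<^sup>2 + n * y * (n - y))"
  proof (rule sum.cong[OF refl])
    fix xs
    have "(\<Sum>z\<in>V. (X xs + b z)\<^sup>2) = (\<Sum>z\<in>V. (X xs)\<^sup>2 + 2 * X xs * b z + (b z)\<^sup>2)"
      by (simp add: power2_sum algebra_simps)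
    also have "\<dots> = n * (X xs)\<^sup>2 + n * y * (n - y)"
      by (simp add: sum.distrib sum_distrib_left[symmetric] b0 b2 n_def)
    finally show "(\<Sum>z\<in>V. (X xs + b z)\<^sup>2) = n * (X xs)\<^sup>2 + n * y * (n - y)" .
  qed
  also have "\<dots> = n * (n ^ M * real M * y * (n - y)) + n ^ M * (n * y * (n - y))"
    by (simp add: sum.distrib sum_distrib_left[symmetric] Suc.IH(2) card_L)
  finally show "(\<Sum>xs\<in>L (Suc M). (X xs)\<^sup>2) = n ^ Suc M * real (Suc M) * y * (n - y)"
    by (simp add: algebra_simps)
qed

section \<open>Codegree vectors and their estimation from samples\<close>

locale dense_triangle_free =
  fixes V :: "'a set" and N :: "'a \<Rightarrow> 'a set" and F :: real
  assumes finite_V: "finite V"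
    and nonempty_V: "V \<noteq> {}"
    and N_sub: "N v \<subseteq> V"
    and N_sym: "w \<in> N v \<Longrightarrow> v \<in> N w"
    and N_disj: "w \<in> N v \<Longrightarrow> N v \<inter> N w = {}"
    and deg: "v \<in> V \<Longrightarrow> real (card V) / 3 - F \<le> real (card (N v))"
    and F_small: "F \<le> real (card V) / 10000"
    and F_pos: "F > 0"
begin

abbreviation "n \<equiv> real (card V)"

definition cd :: "'a \<Rightarrow> 'a \<Rightarrow> real" where
  "cd v x = real (card (N v \<inter> N x))"

definition dist2 :: "'a \<Rightarrow> 'a \<Rightarrow> real" where
  "dist2 u v = (\<Sum>x\<in>V. (cd u x - cd v x)\<^sup>2)"

lemma n_pos: "n > 0"
  using finite_V nonempty_V by (simp add: card_gt_0_iff)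

lemma finite_N [simp]: "finite (N v)"
  using N_sub finite_V by (rule finite_subset)

lemma cd_zero: "x \<in> N v \<Longrightarrow> cd v x = 0"
  by (simp add: cd_def N_disj)

lemma dist2_triangle: "dist2 u w \<le> 2 * dist2 u v + 2 * dist2 v w"
proof -
  have "(cd u x - cd w x)\<^sup>2 \<le> 2 * (cd u x - cd v x)\<^sup>2 + 2 * (cd v x - cd w x)\<^sup>2" for x
  proof -
    have "0 \<le> ((cd u x - cd v x) - (cd v x - cd w x))\<^sup>2" by simp
    then show ?thesis by (simp add: power2_eq_square algebra_simps)
  qed
  then show ?thesis
    unfolding dist2_def sum_distrib_left sum.distrib[symmetric] by (intro sum_mono)
qed

lemma dist2_sym: "dist2 u v = dist2 v u"
  unfolding dist2_def by (simp add: power2_commute)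

lemma dist2_self: "dist2 u u = 0"
  unfolding dist2_def by simp

text \<open>The unbiased estimate of \<open>cd v x\<close>: an observed frequency, scaled by
  \<open>n\<close>.\<close>

definition est :: "'a list \<Rightarrow> 'a \<Rightarrow> 'a \<Rightarrow> real" where
  "est xs v x = n * real (length (filter (\<lambda>z. z \<in> N v \<inter> N x) xs)) / real (length xs)"

definition err :: "'a list \<Rightarrow> 'a \<Rightarrow> real" where
  "err xs v = (\<Sum>x\<in>V. (est xs v x - cd v x)\<^sup>2)"

text \<open>Positions are recorded instead of vertices, because a sample may repeat a vertex; a
  sample of length 1200 then allows at most \<open>2 ^ 1200\<close> values.\<close>

definition hits :: "'a list \<Rightarrow> 'a \<Rightarrow> nat set" where
  "hits xs v = {i. i < length xs \<and> xs ! i \<in> N v}"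

lemma est_hits_cong:
  assumes "hits xs u = hits xs v" shows "est xs u x = est xs v x"
proof -
  have "{i. i < length xs \<and> xs ! i \<in> N w \<inter> N x} = {i \<in> hits xs w. xs ! i \<in> N x}" for w
    by (auto simp: hits_def)
  then show ?thesis
    by (simp only: est_def length_filter_conv_card assms)
qed

text \<open>Coordinates in \<open>N v\<close> have codegree 0 and contribute no error, so at most
  \<open>2 / 3 * n + F\<close> coordinates remain, each with mean squared error at most
  \<open>n\<^sup>2 / (4 * M)\<close>. Counting all \<open>n\<close> coordinates would give
  \<open>n ^ 3 / 4800\<close> for \<open>M = 1200\<close>, above the threshold in
  \<open>card_separated\<close>.\<close>

lemma sum_err:
  assumes v: "v \<in> V" and M: "M > 0"
  shows "(\<Sum>xs | set xs \<subseteq> V \<and> length xs = M. err xs v)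
           \<le> n ^ M * (n\<^sup>2 * (2 / 3 * n + F) / (4 * real M))"
proof -
  let ?L = "{xs. set xs \<subseteq> V \<and> length xs = M}"
  have pt: "(\<Sum>xs\<in>?L. (est xs v x - cd v x)\<^sup>2) = n ^ M * (cd v x * (n - cd v x)) / real M" for x
  proof -
    have "(\<Sum>xs\<in>?L. (est xs v x - cd v x)\<^sup>2) = (\<Sum>xs\<in>?L. (n * real (length (filter (\<lambda>z. z \<in> N v \<inter> N x) xs))
             - real (length xs) * real (card (N v \<inter> N x)))\<^sup>2 / (real M)\<^sup>2)"
      using M by (intro sum.cong) (auto simp: est_def cd_def field_simps)
    also have "\<dots> = n ^ M * real M * cd v x * (n - cd v x) / (real M)\<^sup>2"
      unfolding sum_divide_distrib[symmetric]
      using sample_moments(2)[OF finite_V, of "N v \<inter> N x" M] N_sub by (auto simp: cd_def)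
    also have "\<dots> = n ^ M * (cd v x * (n - cd v x)) / real M"
      using M by (simp add: power2_eq_square)
    finally show ?thesis .
  qed
  have quarter: "r * (n - r) \<le> n\<^sup>2 / 4" for r
  proof -
    have "0 \<le> (r - n / 2)\<^sup>2" by simp
    then show ?thesis by (simp add: power2_eq_square algebra_simps)
  qed
  have "(\<Sum>x\<in>V. cd v x * (n - cd v x)) = (\<Sum>x\<in>V - N v. cd v x * (n - cd v x))"
    by (intro sum.mono_neutral_right) (auto simp: finite_V cd_zero)
  also have "\<dots> \<le> (\<Sum>x\<in>V - N v. n\<^sup>2 / 4)"
    by (intro sum_mono quarter)
  also have "\<dots> = n\<^sup>2 / 4 * (n - real (card (N v)))"
    using N_sub[of v] finite_V by (simp add: card_Diff_subset of_nat_diff card_mono)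
  also have "\<dots> \<le> n\<^sup>2 / 4 * (2 / 3 * n + F)"
    using deg[OF v] by (intro mult_left_mono) auto
  finally have le: "(\<Sum>x\<in>V. cd v x * (n - cd v x)) \<le> n\<^sup>2 / 4 * (2 / 3 * n + F)" .
  have "(\<Sum>xs\<in>?L. err xs v) = (\<Sum>x\<in>V. n ^ M * (cd v x * (n - cd v x)) / real M)"
    unfolding err_def by (subst sum.swap) (simp only: pt)
  also have "\<dots> = n ^ M / real M * (\<Sum>x\<in>V. cd v x * (n - cd v x))"
    by (simp add: sum_distrib_left)
  also have "\<dots> \<le> n ^ M / real M * (n\<^sup>2 / 4 * (2 / 3 * n + F))"
    by (intro mult_left_mono le) auto
  finally show ?thesis by (simp add: field_simps)
qed

text \<open>Equal hits give the same estimate, which serves as an intermediate point between the two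
  codegree vectors.\<close>

lemma dist2_le_err:
  assumes "hits xs u = hits xs v" shows "dist2 u v \<le> 2 * err xs u + 2 * err xs v"
proof -
  have "(cd u x - cd v x)\<^sup>2 \<le> 2 * (est xs u x - cd u x)\<^sup>2 + 2 * (est xs v x - cd v x)\<^sup>2" for x
  proof -
    have "0 \<le> ((est xs u x - cd u x) + (est xs v x - cd v x))\<^sup>2" by simp
    then show ?thesis
      using est_hits_cong[OF assms, of x] by (simp add: power2_eq_square algebra_simps)
  qed
  then show ?thesis
    unfolding dist2_def err_def sum_distrib_left sum.distrib[symmetric] by (intro sum_mono)
qed

text \<open>
  A centre is bad for a sample if its error exceeds a quarter of the squared separation; on
  average less than a \<open>5/6\<close> fraction of the centres is bad, and good centres have distinct sets of hits.
\<close>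

lemma card_separated:
  assumes U: "U \<subseteq> V"
    and sep: "\<And>u v. u \<in> U \<Longrightarrow> v \<in> U \<Longrightarrow> u \<noteq> v \<Longrightarrow> dist2 u v \<ge> n ^ 3 / 1460"
  shows "card U \<le> 6 * 2 ^ 1200"
proof -
  define L where "L = {xs. set xs \<subseteq> V \<and> length xs = 1200}"
  define \<theta> where "\<theta> = n ^ 3 / 5840"
  have \<theta>: "\<theta> > 0" using n_pos by (simp add: \<theta>_def)
  have finU: "finite U" using U finite_V by (rule finite_subset)
  have finL: "finite L" unfolding L_def using finite_V by (rule finite_lists_length_eq)
  have card_L: "real (card L) = n ^ 1200"
    unfolding L_def using card_lists_length_eq[OF finite_V, of 1200] by simp
  define bad where "bad xs = {u \<in> U. err xs u \<ge> \<theta>}" for xs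
  have err0: "err xs u \<ge> 0" for xs u by (simp add: err_def sum_nonneg)
  have one: "(\<Sum>xs\<in>L. err xs u) \<le> 5 / 6 * \<theta> * n ^ 1200" if "u \<in> U" for u
  proof -
    \<comment> \<open>The mean error is about \<open>n ^ 3 / 7200\<close>, and
      \<open>5 / 6 * \<theta>\<close> is \<open>n ^ 3 / 7008\<close>; the gap absorbs
      \<open>F\<close>.\<close>
    have "n\<^sup>2 * (2 / 3 * n + F) / (4 * real 1200) \<le> n\<^sup>2 * (2 / 3 * n + n / 10000) / (4 * real 1200)"
      using F_small by (intro divide_right_mono mult_left_mono) auto
    also have "\<dots> = n ^ 3 * (20003 / 144000000)"
      by (simp add: power2_eq_square power3_eq_cube algebra_simps)
    also have "\<dots> \<le> 5 / 6 * \<theta>"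
      using n_pos by (simp add: \<theta>_def)
    finally have "n\<^sup>2 * (2 / 3 * n + F) / (4 * real 1200) \<le> 5 / 6 * \<theta>" .
    then have "n ^ 1200 * (n\<^sup>2 * (2 / 3 * n + F) / (4 * real 1200)) \<le> n ^ 1200 * (5 / 6 * \<theta>)"
      by (intro mult_left_mono) auto
    with sum_err[of u 1200] that U show ?thesis
      by (simp add: L_def mult.commute subset_iff)
  qed
  \<comment> \<open>Markov's inequality, averaged over all samples: some sample makes at most five
    sixths of \<open>U\<close> bad.\<close>
  have "\<theta> * (\<Sum>xs\<in>L. real (card (bad xs))) = (\<Sum>xs\<in>L. \<Sum>u\<in>bad xs. \<theta>)"
    by (simp add: sum_distrib_left mult.commute)
  also have "\<dots> \<le> (\<Sum>xs\<in>L. \<Sum>u\<in>bad xs. err xs u)"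
    by (intro sum_mono) (auto simp: bad_def)
  also have "\<dots> \<le> (\<Sum>xs\<in>L. \<Sum>u\<in>U. err xs u)"
    by (intro sum_mono sum_mono2) (auto simp: bad_def finU err0)
  also have "\<dots> = (\<Sum>u\<in>U. \<Sum>xs\<in>L. err xs u)" by (rule sum.swap)
  also have "\<dots> \<le> (\<Sum>u\<in>U. 5 / 6 * \<theta> * n ^ 1200)"
    by (intro sum_mono one)
  finally have "(\<Sum>xs\<in>L. real (card (bad xs))) \<le> (\<Sum>xs\<in>L. 5 / 6 * real (card U))"
    using \<theta> by (simp add: card_L mult.commute mult.left_commute)
  moreover have "L \<noteq> {}" using card_L n_pos by auto
  ultimately obtain xs where xs: "xs \<in> L" "real (card (bad xs)) \<le> 5 / 6 * real (card U)"
    using sum_strict_mono[OF finL, of "\<lambda>_. 5 / 6 * real (card U)" "\<lambda>xs. real (card (bad xs))"]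
    by force
  have inj: "inj_on (hits xs) (U - bad xs)"
  proof (rule inj_onI, rule ccontr)
    fix u v assume u: "u \<in> U - bad xs" and v: "v \<in> U - bad xs"
      and tr: "hits xs u = hits xs v" and ne: "u \<noteq> v"
    have "dist2 u v < 4 * \<theta>"
      using dist2_le_err[OF tr] u v by (auto simp: bad_def)
    with sep[of u v] u v ne show False by (auto simp: \<theta>_def)
  qed
  have "hits xs ` (U - bad xs) \<subseteq> Pow {..<1200}"
    using xs by (auto simp: hits_def L_def)
  then have "card (U - bad xs) \<le> 2 ^ 1200"
    using card_inj_on_le[OF inj, of "Pow {..<1200}"] by (simp add: card_Pow)
  moreover have "card (U - bad xs) = card U - card (bad xs)"
    by (rule card_Diff_subset) (auto simp: bad_def finU)
  \<comment> \<open>At least a sixth of \<open>U\<close> is good, whence the factor 6.\<close>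
  moreover have "6 * card (bad xs) \<le> 5 * card U" using xs(2) by linarith
  ultimately show ?thesis by linarith
qed

text \<open>The colours are the centres of a maximal separated family. If the colouring is not
  proper, two adjacent vertices share a centre and are therefore close.\<close>

lemma proper_by_centres:
  shows "(\<exists>c. c ` V \<subseteq> V \<and> card (c ` V) \<le> 6 * 2 ^ 1200 \<and>
              (\<forall>v\<in>V. \<forall>w\<in>N v. c v \<noteq> (c w :: 'a)))
         \<or> (\<exists>v\<in>V. \<exists>w\<in>N v. dist2 v w < n ^ 3 / 365)"
proof -
  define sep where "sep U \<longleftrightarrow> (\<forall>u\<in>U. \<forall>v\<in>U. u \<noteq> v \<longrightarrow> dist2 u v \<ge> n ^ 3 / 1460)" for U
  have "finite {U. U \<subseteq> V \<and> sep U}" using finite_V by simp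
  moreover have "{} \<in> {U. U \<subseteq> V \<and> sep U}" by (simp add: sep_def)
  ultimately obtain U where "U \<in> {U. U \<subseteq> V \<and> sep U}"
    and "\<forall>U'\<in>{U. U \<subseteq> V \<and> sep U}. U \<subseteq> U' \<longrightarrow> U = U'"
    using finite_has_maximal[of "{U. U \<subseteq> V \<and> sep U}"] by blast
  then have U: "U \<subseteq> V" "sep U"
    and max: "\<And>U'. U' \<subseteq> V \<Longrightarrow> sep U' \<Longrightarrow> U \<subseteq> U' \<Longrightarrow> U' = U"
    by blast+
  have near: "\<exists>u\<in>U. dist2 u v < n ^ 3 / 1460" if v: "v \<in> V" for v
  proof (rule ccontr)
    assume "\<not> ?thesis"
    then have far: "\<And>u. u \<in> U \<Longrightarrow> dist2 u v \<ge> n ^ 3 / 1460" by force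
    then have "sep (insert v U)"
      using U(2) by (auto simp: sep_def dist2_sym)
    then have "v \<in> U" using max[of "insert v U"] U(1) v by auto
    then show False using far[of v] n_pos by (simp add: dist2_self)
  qed
  then obtain c where c: "\<And>v. v \<in> V \<Longrightarrow> c v \<in> U \<and> dist2 (c v) v < n ^ 3 / 1460"
    by metis
  have "card (c ` V) \<le> card U"
    using c U(1) finite_V by (intro card_mono) (auto intro: finite_subset)
  also have "\<dots> \<le> 6 * 2 ^ 1200"
    using U by (intro card_separated) (auto simp: sep_def)
  finally have card: "card (c ` V) \<le> 6 * 2 ^ 1200" .
  show ?thesis
  proof (cases "\<exists>v\<in>V. \<exists>w\<in>N v. c v = c w")
    case True
    then obtain v w where vw: "v \<in> V" "w \<in> N v" "c v = c w" by auto
    then have w: "w \<in> V" using N_sub by auto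
    \<comment> \<open>Two squared distances below \<open>n ^ 3 / 1460\<close>, each doubled, add up
      to less than \<open>n ^ 3 / 365\<close>.\<close>
    have "dist2 v w \<le> 2 * dist2 v (c v) + 2 * dist2 (c v) w"
      by (rule dist2_triangle)
    also have "\<dots> < n ^ 3 / 365"
      using c[OF vw(1)] c[OF w] vw(3) dist2_sym[of v "c v"] by auto
    finally show ?thesis using vw by blast
  next
    case False
    with card c U(1) show ?thesis by blast
  qed
qed

section \<open>An independent set from an edge with close codegree vectors\<close>

definition indep :: "'a set \<Rightarrow> bool" where
  "indep I \<longleftrightarrow> I \<subseteq> V \<and> (\<forall>u\<in>I. N u \<inter> I = {})"

lemma card_disjoint_le:
  assumes "finite C" "X \<subseteq> C" "Y \<subseteq> C" "X \<inter> Y = {}"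
  shows "real (card X) + real (card Y) \<le> real (card C)"
  using card_mono[of C "X \<union> Y"] assms card_Un_disjoint[of X Y] finite_subset[of _ C] by force

text \<open>For \<open>x\<close> in \<open>S\<close> one of the two codegrees vanishes, so
  \<open>a x\<close> counts the neighbours of \<open>x\<close> in \<open>S\<close>. Each edge inside
  \<open>S\<close> has an end with \<open>a\<close> at least \<open>\<tau>\<close>; closeness of the
  codegree vectors makes such vertices rare, and deleting them leaves \<open>I\<close>.\<close>

lemma indep_of_close_edge:
  assumes v: "v \<in> V" and w: "w \<in> N v" and close: "dist2 v w < n ^ 3 / 365"
  shows "\<exists>I. indep I \<and> real (card I) \<ge> 2 / 3 * n - 2 * F - n / 10"
proof -
  \<comment> \<open>\<open>2 * \<tau>\<close> is the excess of two disjoint neighbourhoods of size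
    \<open>n / 3 - F\<close> over the room \<open>n / 3 + 2 * F\<close> outside
    \<open>S\<close>.\<close>
  define \<tau> where "\<tau> = n / 6 - 2 * F"
  define a where "a x = \<bar>cd v x - cd w x\<bar>" for x
  define S where "S = N v \<union> N w"
  define I where "I = {x \<in> S. a x < \<tau>}"
  have wV: "w \<in> V" using w N_sub by auto
  have disj: "N v \<inter> N w = {}" using N_disj[OF w] .
  have SV: "S \<subseteq> V" using N_sub by (auto simp: S_def)
  have finS: "finite S" by (simp add: S_def)
  have cardS: "real (card S) = real (card (N v)) + real (card (N w))"
    unfolding S_def using disj by (simp add: card_Un_disjoint)
  have cardC: "real (card (V - S)) \<le> n / 3 + 2 * F"
    using cardS deg[OF v] deg[OF wV] SV finite_V
    by (simp add: card_Diff_subset finS of_nat_diff card_mono)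
  have \<tau>: "\<tau> \<ge> n * 1664 / 10000" using F_small n_pos by (simp add: \<tau>_def)
  \<comment> \<open>\<open>N s\<close> and \<open>N t\<close> are disjoint and outside \<open>S\<close> there is room for only \<open>n / 3 + 2 * F\<close> vertices.\<close>
  have cross: "a s + a t \<ge> 2 * \<tau>" if s: "s \<in> N v" and t: "t \<in> N w" and st: "t \<in> N s" for s t
  proof -
    have sV: "s \<in> V" and tV: "t \<in> V" using s t N_sub by auto
    have as: "a s = real (card (N s \<inter> N w))"
      using cd_zero[OF s] by (simp add: a_def cd_def Int_commute)
    have at: "a t = real (card (N t \<inter> N v))"
      using cd_zero[OF t] by (simp add: a_def cd_def Int_commute)
    have ds: "real (card (N s)) = a s + real (card (N s \<inter> (V - S)))"
    proof -
      have "N s = (N s \<inter> N w) \<union> (N s \<inter> (V - S))"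
        using N_disj[OF s] N_sub[of s] by (auto simp: S_def)
      moreover have "(N s \<inter> N w) \<inter> (N s \<inter> (V - S)) = {}" by (auto simp: S_def)
      ultimately show ?thesis
        unfolding as using card_Un_disjoint[of "N s \<inter> N w" "N s \<inter> (V - S)"] by simp
    qed
    have dt: "real (card (N t)) = a t + real (card (N t \<inter> (V - S)))"
    proof -
      have "N t = (N t \<inter> N v) \<union> (N t \<inter> (V - S))"
        using N_disj[OF t] N_sub[of t] by (auto simp: S_def)
      moreover have "(N t \<inter> N v) \<inter> (N t \<inter> (V - S)) = {}" by (auto simp: S_def)
      ultimately show ?thesis
        unfolding at using card_Un_disjoint[of "N t \<inter> N v" "N t \<inter> (V - S)"] by simp
    qed
    have "real (card (N s \<inter> (V - S))) + real (card (N t \<inter> (V - S))) \<le> real (card (V - S))"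
      using N_disj[OF st] finite_V by (intro card_disjoint_le) auto
    with ds dt cardC deg[OF sV] deg[OF tV] show ?thesis by (simp add: \<tau>_def)
  qed
  have "indep I"
    unfolding indep_def
  proof (intro conjI ballI)
    show "I \<subseteq> V" using SV by (auto simp: I_def)
    fix s assume s: "s \<in> I"
    show "N s \<inter> I = {}"
    proof (rule ccontr)
      assume "N s \<inter> I \<noteq> {}"
      then obtain t where t: "t \<in> N s" "t \<in> I" by auto
      have lt: "a s + a t < 2 * \<tau>" using s t by (auto simp: I_def)
      \<comment> \<open>An edge inside \<open>N v\<close> or inside \<open>N w\<close> would close a
        triangle, so an edge in \<open>S\<close> joins the two parts.\<close>
      have "\<not> (s \<in> N u \<and> t \<in> N u)" for u
        using N_disj[of s u] t(1) by auto
      then consider "s \<in> N v" "t \<in> N w" | "t \<in> N v" "s \<in> N w"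
        using s t(2) by (auto simp: I_def S_def)
      then show False
        using cross[of s t] cross[of t s] t(1) N_sym[OF t(1)] lt by cases auto
    qed
  qed
  moreover have "real (card I) \<ge> 2 / 3 * n - 2 * F - n / 10"
  proof -
    have "real (card (S - I)) * (n * 1664 / 10000)\<^sup>2 = (\<Sum>x\<in>S - I. (n * 1664 / 10000)\<^sup>2)" by simp
    also have "\<dots> \<le> (\<Sum>x\<in>S - I. (cd v x - cd w x)\<^sup>2)"
    proof (rule sum_mono)
      fix x assume "x \<in> S - I"
      then have "a x \<ge> n * 1664 / 10000" using \<tau> by (auto simp: I_def)
      then show "(n * 1664 / 10000)\<^sup>2 \<le> (cd v x - cd w x)\<^sup>2"
        unfolding a_def using n_pos by (simp add: abs_le_square_iff[symmetric])
    qed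
    also have "\<dots> \<le> dist2 v w"
      unfolding dist2_def using SV finite_V by (intro sum_mono2) auto
    also have "\<dots> < n ^ 3 / 365" by (rule close)
    \<comment> \<open>The constant 365 is fitted to this step: the square of 0.1664 exceeds
      10/365.\<close>
    also have "\<dots> \<le> n / 10 * (n * 1664 / 10000)\<^sup>2"
      using n_pos by (simp add: power2_eq_square power3_eq_cube)
    finally have "real (card (S - I)) < n / 10"
      using n_pos by (simp add: mult_less_cancel_right)
    moreover have "real (card (S - I)) = real (card S) - real (card I)"
    proof -
      have "I \<subseteq> S" by (auto simp: I_def)
      then show ?thesis
        using finS by (simp add: card_Diff_subset finite_subset of_nat_diff card_mono)
    qed
    ultimately show ?thesis using cardS deg[OF v] deg[OF wV] by linarith
  qed
  ultimately show ?thesis by blast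
qed

end

section \<open>Structure around a maximum independent set\<close>

locale max_indep = dense_triangle_free +
  fixes I :: "'a set"
  assumes indep_I: "indep I"
    and max_I: "indep J \<Longrightarrow> card J \<le> card I"
begin

definition "B = V - I"
text \<open>The deficit of \<open>I\<close> against the ideal size; it is real and may be
  negative.\<close>

definition "t = 2 / 3 * n - real (card I)"
definition "b u = real (card (N u \<inter> B))"

lemma IV: "I \<subseteq> V" and IN: "u \<in> I \<Longrightarrow> N u \<inter> I = {}"
  using indep_I by (auto simp: indep_def)

lemma finite_I [simp]: "finite I" and finite_B [simp]: "finite B"
  using IV finite_V by (auto simp: B_def finite_subset)

lemma card_B: "real (card B) = n / 3 + t"
  using IV finite_V by (simp add: B_def t_def card_Diff_subset of_nat_diff card_mono)

lemma N_split: "real (card (N u)) = real (card (N u \<inter> I)) + b u"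
proof -
  have "N u = (N u \<inter> I) \<union> (N u \<inter> B)" using N_sub[of u] by (auto simp: B_def)
  moreover have "(N u \<inter> I) \<inter> (N u \<inter> B) = {}" by (auto simp: B_def)
  ultimately show ?thesis
    unfolding b_def using card_Un_disjoint[of "N u \<inter> I" "N u \<inter> B"] by simp
qed

lemma neighbour_in_I:
  assumes u: "u \<in> B" shows "\<exists>w\<in>I. u \<in> N w"
proof (rule ccontr)
  assume no: "\<not> ?thesis"
  \<comment> \<open>\<open>N_disj\<close> with both vertices equal rules out loops.\<close>
  have "u \<notin> N u" using N_disj[of u u] by auto
  then have "indep (insert u I)"
    using no u IV IN N_sym by (fastforce simp: indep_def B_def)
  from max_I[OF this] u show False by (simp add: B_def)
qed

lemma missed_in_B:
  assumes w: "w \<in> I" shows "real (card (B - N w)) \<le> t + F"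
proof -
  have "N w \<subseteq> B" using IN[OF w] N_sub[of w] by (auto simp: B_def)
  then have "real (card (B - N w)) = real (card B) - real (card (N w))"
    by (simp add: card_Diff_subset of_nat_diff card_mono)
  with deg[of w] w IV card_B show ?thesis by auto
qed

lemma common_neighbour_missed:
  assumes "w \<in> I" "u \<in> N w" shows "N u \<inter> B \<subseteq> B - N w"
  using N_disj[OF assms(2)] by auto

text \<open>By maximality \<open>u\<close> has a neighbour \<open>w\<close> in \<open>I\<close>. By
  triangle-freeness \<open>N u\<close> avoids \<open>N w\<close>, which covers all but
  \<open>t + F\<close> vertices of \<open>B\<close>.\<close>

lemma b_le:
  assumes u: "u \<in> B" shows "b u \<le> t + F"
proof -
  obtain w where w: "w \<in> I" "u \<in> N w" using neighbour_in_I[OF u] by auto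
  have "b u \<le> real (card (B - N w))"
    unfolding b_def using common_neighbour_missed[OF w] by (simp add: card_mono)
  with missed_in_B[OF w(1)] show ?thesis by simp
qed

lemma card_N_I:
  assumes u: "u \<in> B" shows "real (card (N u \<inter> I)) \<ge> n / 3 - F - b u"
  using deg[of u] N_split[of u] u by (auto simp: B_def)

lemma card_I: "real (card I) = 2 / 3 * n - t"
  by (simp add: t_def)

text \<open>Count the edges between \<open>U\<close> and \<open>I\<close> twice: every vertex of
  \<open>I\<close> sees at most two members of \<open>U\<close>, while each member of
  \<open>U\<close> sees almost half of \<open>I\<close> or more, up to the error terms in
  \<open>t\<close> and \<open>F\<close>.\<close>

lemma card_disjoint_family:
  assumes big: "t > 8 * F" and t: "t \<le> n / 10 + 2 * F"
    and U: "U \<subseteq> B" "\<And>u. u \<in> U \<Longrightarrow> b u \<ge> t / 2 - F"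
    and disj: "\<And>u v. u \<in> U \<Longrightarrow> v \<in> U \<Longrightarrow> u \<noteq> v \<Longrightarrow> N u \<inter> N v \<inter> B = {}"
  shows "card U \<le> 5"
proof (rule ccontr)
  assume "\<not> ?thesis"
  then have six: "6 \<le> real (card U)" by simp
  have finU: "finite U" using U(1) finite_B by (rule finite_subset)
  have two: "real (card (U \<inter> N w)) \<le> 2" if w: "w \<in> I" for w
  proof (rule ccontr)
    assume "\<not> ?thesis"
    then have three: "3 \<le> real (card (U \<inter> N w))" by simp
    \<comment> \<open>Three disjoint neighbourhoods packed into \<open>B - N w\<close> would force
      \<open>t \<le> 8 * F\<close>; this is the origin of the 8.\<close>
    have "3 * (t / 2 - F) \<le> real (card (U \<inter> N w)) * (t / 2 - F)"
      using big F_pos by (intro mult_right_mono three) auto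
    also have "\<dots> = (\<Sum>u\<in>U \<inter> N w. t / 2 - F)" by simp
    also have "\<dots> \<le> (\<Sum>u\<in>U \<inter> N w. real (card (N u \<inter> B)))"
      using U(2) by (intro sum_mono) (auto simp: b_def)
    also have "\<dots> = real (card (\<Union>u\<in>U \<inter> N w. N u \<inter> B))"
      using finU disj by (subst card_UN_disjoint) auto
    also have "\<dots> \<le> real (card (B - N w))"
      using common_neighbour_missed[OF w] by (intro of_nat_mono card_mono) auto
    also have "\<dots> \<le> t + F" by (rule missed_in_B[OF w])
    finally show False using big by simp
  qed
  have pos: "n / 3 - t - 2 * F \<ge> 0" using t F_small n_pos by simp
  have "6 * (n / 3 - t - 2 * F) \<le> real (card U) * (n / 3 - t - 2 * F)"
    using six pos by (rule mult_right_mono)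
  also have "\<dots> = (\<Sum>u\<in>U. n / 3 - t - 2 * F)" by simp
  also have "\<dots> \<le> (\<Sum>u\<in>U. real (card (N u \<inter> I)))"
  proof (rule sum_mono)
    fix u assume "u \<in> U"
    then have "u \<in> B" using U(1) by auto
    from card_N_I[OF this] b_le[OF this] show "n / 3 - t - 2 * F \<le> real (card (N u \<inter> I))" by simp
  qed
  also have "\<dots> = (\<Sum>u\<in>U. \<Sum>w\<in>I. of_bool (w \<in> N u))"
    by (simp add: of_bool_def sum.If_cases Int_commute)
  also have "\<dots> = (\<Sum>w\<in>I. \<Sum>u\<in>U. of_bool (w \<in> N u))" by (rule sum.swap)
  also have "\<dots> = (\<Sum>w\<in>I. real (card (U \<inter> N w)))"
  proof (rule sum.cong[OF refl])
    fix w
    have "U \<inter> {u. w \<in> N u} = U \<inter> N w" using N_sym by blast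
    then show "(\<Sum>u\<in>U. of_bool (w \<in> N u)) = real (card (U \<inter> N w))"
      using finU by (simp add: of_bool_def sum.If_cases)
  qed
  also have "\<dots> \<le> (\<Sum>w\<in>I. 2)" by (intro sum_mono two)
  also have "\<dots> = 2 * (2 / 3 * n - t)" by (simp add: card_I)
  finally show False using t F_small n_pos by simp
qed

text \<open>
  Within \<open>I\<close>, the neighbourhoods of \<open>x\<close> and \<open>y\<close> almost fill the complementary parts \<open>N v\<close> and
  \<open>N u\<close>, so no room is left for the neighbourhood of \<open>z\<close>.
\<close>

lemma no_edge_in_class:
  assumes t: "t \<le> n / 10 + 2 * F" and uv: "v \<in> N u"
    and B: "u \<in> B" "v \<in> B" "z \<in> B" "x \<in> B" "y \<in> B"
    and x: "x \<in> N u" "x \<in> N z" and y: "y \<in> N v" "y \<in> N z"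
  shows False
proof -
  let ?T = "\<lambda>v. N v \<inter> I"
  define g where "g = n / 3 - t - 2 * F"
  have g: "real (card (?T v)) \<ge> g" if "v \<in> B" for v
    using card_N_I[OF that] b_le[OF that] by (simp add: g_def)
  have "real (card (?T x \<inter> ?T y)) + real (card (?T u \<union> ?T v)) \<le> real (card I)"
    using N_disj[OF x(1)] N_disj[OF y(1)] by (intro card_disjoint_le) auto
  moreover have "card (?T u \<union> ?T v) = card (?T u) + card (?T v)"
    using N_disj[OF uv] by (intro card_Un_disjoint) auto
  moreover have "card (?T x) + card (?T y) = card (?T x \<union> ?T y) + card (?T x \<inter> ?T y)"
    by (intro card_Un_Int) auto
  moreover have "real (card (?T z)) + real (card (?T x \<union> ?T y)) \<le> real (card I)"
    using N_disj[OF x(2)] N_disj[OF y(2)] by (intro card_disjoint_le) auto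
  \<comment> \<open>The parts of \<open>x\<close> and \<open>y\<close> overlap in at most
    \<open>card I - 2 * g\<close> vertices, so their union has at least
    \<open>4 * g - card I\<close>, and the part of \<open>z\<close> adds \<open>g\<close> more. The
    result contradicts \<open>t \<le> n / 10 + 2 * F\<close>.\<close>
  ultimately have "5 * g \<le> 2 * real (card I)"
    using g[OF B(1)] g[OF B(2)] g[OF B(3)] g[OF B(4)] g[OF B(5)] by linarith
  then show False using t F_small n_pos by (simp add: g_def card_I)
qed

text \<open>One colour serves \<open>I\<close>, one the vertices of small degree in
  \<open>B\<close>, and five the remaining vertices, classified by a member of a maximal family with
  disjoint neighbourhoods in \<open>B\<close>.\<close>

lemma few_colours:
  assumes big: "t > 8 * F" and t: "t \<le> n / 10 + 2 * F"
  shows "\<exists>c :: 'a \<Rightarrow> nat. c ` V \<subseteq> {..<7} \<and> (\<forall>v\<in>V. \<forall>w\<in>N v. c v \<noteq> c w)"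
proof -
  define H where "H = {u \<in> B. b u \<ge> t / 2 - F}"
  define dj where "dj U \<longleftrightarrow> (\<forall>u\<in>U. \<forall>v\<in>U. u \<noteq> v \<longrightarrow> N u \<inter> N v \<inter> B = {})" for U
  have "finite {U. U \<subseteq> H \<and> dj U}" by (simp add: H_def)
  moreover have "{} \<in> {U. U \<subseteq> H \<and> dj U}" by (simp add: dj_def)
  ultimately obtain U where "U \<in> {U. U \<subseteq> H \<and> dj U}"
    and "\<forall>U'\<in>{U. U \<subseteq> H \<and> dj U}. U \<subseteq> U' \<longrightarrow> U = U'"
    using finite_has_maximal[of "{U. U \<subseteq> H \<and> dj U}"] by blast
  then have U: "U \<subseteq> H" "dj U"
    and max: "\<And>U'. U' \<subseteq> H \<Longrightarrow> dj U' \<Longrightarrow> U \<subseteq> U' \<Longrightarrow> U' = U"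
    by blast+
  have card_U: "card U \<le> 5"
    using U by (intro card_disjoint_family[OF big t]) (auto simp: H_def dj_def)
  have "finite U" using U(1) by (auto simp: H_def intro: finite_subset)
  then obtain idx where idx: "bij_betw idx U {0..<card U}"
    using ex_bij_betw_finite_nat by blast
  have meet: "\<exists>z\<in>U. N u \<inter> N z \<inter> B \<noteq> {}" if u: "u \<in> H" for u
  proof (rule ccontr)
    assume no: "\<not> ?thesis"
    then have "dj (insert u U)" using U(2) by (auto simp: dj_def)
    \<comment> \<open>A member of \<open>U\<close> is its own witness, since
      \<open>t / 2 - F\<close> is positive and its neighbourhood in \<open>B\<close> is thus
      nonempty.\<close>
    then have "u \<in> U" using max[of "insert u U"] U(1) u by auto
    with no have "N u \<inter> B = {}" by auto
    then have "b u = 0" by (simp add: b_def)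
    with u big F_pos show False by (simp add: H_def)
  qed
  then obtain j where j: "\<And>u. u \<in> H \<Longrightarrow> j u \<in> U \<and> N u \<inter> N (j u) \<inter> B \<noteq> {}"
    by metis
  define c where "c v = (if v \<in> I then 0 else if v \<in> H then 2 + idx (j v) else 1)" for v
  have "idx (j u) < 5" if "u \<in> H" for u
    using bij_betwE[OF idx] j[OF that] card_U by fastforce
  then have "c ` V \<subseteq> {..<7}" by (auto simp: c_def)
  moreover have "c v \<noteq> c w" if v: "v \<in> V" and w: "w \<in> N v" for v w
  proof
    assume eq: "c v = c w"
    have wV: "w \<in> V" using w N_sub by auto
    have "v \<in> I \<longleftrightarrow> w \<in> I" "v \<in> H \<longleftrightarrow> w \<in> H"
      using eq by (auto simp: c_def H_def B_def split: if_splits)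
    moreover have "\<not> (v \<in> I \<and> w \<in> I)" using IN[of v] w by auto
    ultimately consider "v \<in> H" "w \<in> H" | "v \<in> B - H" "w \<in> B - H"
      using v wV by (auto simp: B_def)
    then show False
    proof cases
      case 1
      then have "idx (j v) = idx (j w)" using eq by (auto simp: c_def H_def B_def)
      then have jj: "j w = j v"
        using idx j[OF 1(1)] j[OF 1(2)] by (auto simp: bij_betw_def inj_on_def)
      obtain x where x: "x \<in> N v" "x \<in> N (j v)" "x \<in> B" using j[OF 1(1)] by auto
      obtain y where y: "y \<in> N w" "y \<in> N (j v)" "y \<in> B" using j[OF 1(2)] jj by auto
      have "j v \<in> B" "v \<in> B" "w \<in> B" using j[OF 1(1)] U(1) 1 by (auto simp: H_def)
      with no_edge_in_class[OF t w _ _ _ x(3) y(3) x(1,2) y(1,2)] show False by blast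
    next
      case 2
      then have "v \<in> B" "w \<in> B" by auto
      \<comment> \<open>Two adjacent vertices of small degree in \<open>B\<close> have disjoint
        neighbourhoods in \<open>I\<close>, each larger than half of \<open>I\<close>.\<close>
      moreover have "real (card (N v \<inter> I)) + real (card (N w \<inter> I)) \<le> real (card I)"
        using N_disj[OF w] by (intro card_disjoint_le) auto
      ultimately have "2 * (n / 3 - F) - b v - b w \<le> 2 / 3 * n - t"
        using card_N_I[of v] card_N_I[of w] by (simp add: card_I)
      moreover have "b v < t / 2 - F" "b w < t / 2 - F" using 2 by (auto simp: H_def)
      then have "b v + b w < t - 2 * F" by linarith
      ultimately have "2 * (n / 3 - F) - (b v + b w) \<le> 2 / 3 * n - t \<and> b v + b w < t - 2 * F" by linarith
      then show False by argo
    qed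
  qed
  ultimately show ?thesis by blast
qed

definition "I2 = {u \<in> B. real (card (N u \<inter> I)) > real (card I) / 2}"

lemma indep_I2: "indep I2"
proof -
  have False if "u \<in> I2" "v \<in> I2" "v \<in> N u" for u v
  proof -
    have "real (card (N u \<inter> I)) + real (card (N v \<inter> I)) \<le> real (card I)"
      using N_disj[OF that(3)] by (intro card_disjoint_le) auto
    with that(1,2) show False by (auto simp: I2_def)
  qed
  then show ?thesis by (auto simp: indep_def I2_def B_def)
qed

text \<open>Count nonadjacent pairs between \<open>B - I2\<close> and \<open>I\<close>: each vertex
  of \<open>B - I2\<close> misses at least half of \<open>I\<close>, and each vertex of
  \<open>I\<close> misses at most \<open>t + F\<close> of \<open>B\<close>. Hence
  \<open>B - I2\<close> has at most \<open>2 * (t + F)\<close> elements.\<close>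

lemma card_I2:
  assumes I0: "I \<noteq> {}" shows "real (card I2) \<ge> n / 3 - t - 2 * F"
proof -
  define A where "A = B - I2"
  have AB: "A \<subseteq> B" and finA: "finite A" by (auto simp: A_def)
  have pos: "real (card I) > 0" using I0 by (simp add: card_gt_0_iff)
  have "real (card A) * (real (card I) / 2) = (\<Sum>u\<in>A. real (card I) / 2)" by simp
  also have "\<dots> \<le> (\<Sum>u\<in>A. real (card (I - N u)))"
  proof (rule sum_mono)
    fix u assume "u \<in> A"
    then have "real (card (N u \<inter> I)) \<le> real (card I) / 2" by (auto simp: A_def I2_def)
    moreover have "real (card (I - N u)) = real (card I) - real (card (N u \<inter> I))"
      by (simp add: card_Diff_subset_Int of_nat_diff card_mono Int_commute)
    ultimately show "real (card I) / 2 \<le> real (card (I - N u))" by simp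
  qed
  also have "\<dots> = (\<Sum>u\<in>A. \<Sum>w\<in>I. of_bool (w \<notin> N u))"
    by (simp add: of_bool_def sum.If_cases Diff_eq Collect_neg_eq)
  also have "\<dots> = (\<Sum>w\<in>I. \<Sum>u\<in>A. of_bool (w \<notin> N u))" by (rule sum.swap)
  also have "\<dots> \<le> (\<Sum>w\<in>I. t + F)"
  proof (rule sum_mono)
    fix w assume w: "w \<in> I"
    have "A \<inter> {u. w \<notin> N u} = A - N w" using N_sym by blast
    then have "(\<Sum>u\<in>A. of_bool (w \<notin> N u)) = real (card (A - N w))"
      using finA by (simp add: of_bool_def sum.If_cases)
    also have "\<dots> \<le> real (card (B - N w))" using AB by (intro of_nat_mono card_mono) auto
    finally show "(\<Sum>u\<in>A. of_bool (w \<notin> N u)) \<le> t + F" using missed_in_B[OF w] by simp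
  qed
  also have "\<dots> = 2 * (t + F) * (real (card I) / 2)" by simp
  finally have "real (card A) \<le> 2 * (t + F)"
    using pos by (simp only: mult_le_cancel_right)
  moreover have "real (card A) = real (card B) - real (card I2)"
  proof -
    have "I2 \<subseteq> B" by (auto simp: I2_def)
    then show ?thesis
      unfolding A_def by (simp add: card_Diff_subset finite_subset[OF _ finite_B] of_nat_diff card_mono)
  qed
  ultimately show ?thesis by (simp add: card_B)
qed

end

text \<open>A large chromatic number will exclude both colourings. In the partition,
  \<open>10 * F\<close> is \<open>t + 2 * F\<close> with \<open>t \<le> 8 * F\<close>, and the upper
  bound on \<open>I\<close> holds because \<open>I\<close> misses the neighbourhood of each of its
  vertices.\<close>

theorem (in dense_triangle_free) colouring_or_partition:
  shows "(\<exists>c :: 'a \<Rightarrow> 'a. c ` V \<subseteq> V \<and> card (c ` V) \<le> 6 * 2 ^ 1200 \<and> (\<forall>v\<in>V. \<forall>w\<in>N v. c v \<noteq> c w))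
       \<or> (\<exists>c :: 'a \<Rightarrow> nat. c ` V \<subseteq> {..<7} \<and> (\<forall>v\<in>V. \<forall>w\<in>N v. c v \<noteq> c w))
       \<or> (\<exists>I J. indep I \<and> indep J \<and> I \<inter> J = {} \<and>
            real (card I) \<ge> 2 / 3 * n - 8 * F \<and> real (card I) \<le> 2 / 3 * n + F \<and>
            real (card J) \<ge> n / 3 - 10 * F \<and>
            (\<forall>a\<in>V - I. real (card (N a \<inter> I)) \<ge> n / 3 - 10 * F))"
    (is "?P \<or> ?Q \<or> ?R")
proof (rule ccontr)
  assume no: "\<not> ?thesis"
  then obtain v w where "v \<in> V" "w \<in> N v" "dist2 v w < n ^ 3 / 365"
    using proper_by_centres by blast
  then obtain I0 where I0: "indep I0" "real (card I0) \<ge> 2 / 3 * n - 2 * F - n / 10"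
    using indep_of_close_edge by blast
  have "\<forall>J. indep J \<longrightarrow> card J < Suc (card V)"
    using finite_V by (auto simp: indep_def less_Suc_eq_le intro: card_mono)
  from ex_has_greatest_nat[where P = indep and f = card, OF I0(1) this]
  obtain I where I: "indep I" "\<And>J. indep J \<Longrightarrow> card J \<le> card I" by blast
  interpret max_indep V N F I
    using I by unfold_locales
  have t: "t \<le> n / 10 + 2 * F"
    using I0(2) max_I[OF I0(1)] by (simp add: t_def)
  have t8: "t \<le> 8 * F"
    using few_colours[OF _ t] no by force
  have ne: "I \<noteq> {}"
    using t F_small n_pos card_I by auto
  then obtain w where w: "w \<in> I" by auto
  have "real (card I) + real (card (N w)) \<le> n"
    using IN[OF w] IV N_sub finite_V by (intro card_disjoint_le) auto
  then have "real (card I) \<le> 2 / 3 * n + F"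
    using deg[of w] w IV by auto
  moreover have "real (card (N a \<inter> I)) \<ge> n / 3 - 10 * F" if "a \<in> V - I" for a
    using card_N_I[of a] b_le[of a] that t8 by (simp add: B_def)
  moreover have "I \<inter> I2 = {}" by (auto simp: I2_def B_def)
  moreover have "real (card I2) \<ge> n / 3 - 10 * F" using card_I2[OF ne] t8 by simp
  moreover have "real (card I) \<ge> 2 / 3 * n - 8 * F" using t8 by (simp add: card_I)
  ultimately have ?R using indep_I indep_I2 by blast
  with no show False by blast
qed

section \<open>Transfer to graphs: Kneser homomorphisms and chromatic number\<close>

lemma hom_to_kneser_graph:
  fixes T :: "'a \<Rightarrow> 'b set"
  assumes I: "finite I" "card I \<le> 2 * m + k"
    and T: "\<And>a. a \<in> verts F \<Longrightarrow> T a \<subseteq> I \<and> card (T a) \<ge> m"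
    and arc: "\<And>a b. a \<rightarrow>\<^bsub>F\<^esub> b \<Longrightarrow> a \<in> verts F \<and> b \<in> verts F \<and> T a \<inter> T b = {}"
  shows "\<exists>h. graph_hom F (with_proj (kneser_graph m k)) h"
proof -
  have "\<exists>\<phi>. \<phi> ` I \<subseteq> {1..2 * m + k} \<and> inj_on \<phi> I"
    using card_le_inj[OF I(1), of "{1..2 * m + k}"] I(2) by auto
  then obtain \<phi> where \<phi>: "\<phi> ` I \<subseteq> {1..2 * m + k}" "inj_on \<phi> I" by blast
  \<comment> \<open>Shrinking each \<open>T a\<close> to exactly \<open>m\<close> elements and
    relabelling \<open>I\<close> injectively both preserve disjointness.\<close>
  have "\<exists>S. S \<subseteq> T a \<and> card S = m" if "a \<in> verts F" for a
    using obtain_subset_with_card_n[of m "T a"] T[OF that] by metis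
  then obtain S where S: "\<And>a. a \<in> verts F \<Longrightarrow> S a \<subseteq> T a \<and> card (S a) = m" by metis
  define h where "h a = \<phi> ` S a" for a
  have vert: "h a \<subseteq> {1..2 * m + k} \<and> card (h a) = m" if "a \<in> verts F" for a
  proof -
    have "S a \<subseteq> I" using S[OF that] T[OF that] by auto
    then show ?thesis using \<phi> S[OF that] by (auto simp: h_def card_image inj_on_subset)
  qed
  have disj: "h a \<inter> h b = {}" if "a \<rightarrow>\<^bsub>F\<^esub> b" for a b
  proof -
    have ab: "a \<in> verts F" "b \<in> verts F" "T a \<inter> T b = {}" using arc[OF that] by auto
    then have "S a \<subseteq> I" "S b \<subseteq> I" using S T by blast+
    then have "h a \<inter> h b = \<phi> ` (S a \<inter> S b)"
      unfolding h_def using inj_on_image_Int[OF \<phi>(2)] by simp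
    also have "S a \<inter> S b = {}" using S[OF ab(1)] S[OF ab(2)] ab(3) by auto
    finally show ?thesis by simp
  qed
  have "graph_hom F (with_proj (kneser_graph m k)) h"
    unfolding graph_hom_def
  proof (intro conjI allI impI)
    show "h ` verts F \<subseteq> verts (with_proj (kneser_graph m k))"
      using vert by (auto simp: kneser_graph_def Let_def)
    show "h a \<rightarrow>\<^bsub>with_proj (kneser_graph m k)\<^esub> h b" if "a \<rightarrow>\<^bsub>F\<^esub> b" for a b
      using arc[OF that] disj[OF that] vert[of a] vert[of b]
      by (simp add: kneser_graph_def Let_def)
  qed
  then show ?thesis by blast
qed

lemma chromatic_number_le:
  assumes "c ` verts G \<subseteq> C" "finite C" "card C \<le> k" "\<And>u v. u \<rightarrow>\<^bsub>G\<^esub> v \<Longrightarrow> c u \<noteq> c v"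
    and wf: "\<And>u v. u \<rightarrow>\<^bsub>G\<^esub> v \<Longrightarrow> u \<in> verts G \<and> v \<in> verts G"
  shows "chromatic_number G \<le> k"
proof -
  obtain h where h: "bij_betw h C {0..<card C}"
    using ex_bij_betw_finite_nat[OF assms(2)] by blast
  have "proper_coloring G k (h \<circ> c)"
    unfolding proper_coloring_def
  proof (intro conjI allI impI)
    show "(h \<circ> c) ` verts G \<subseteq> {..<k}"
      using assms(1,3) bij_betwE[OF h] by fastforce
    fix u v assume uv: "u \<rightarrow>\<^bsub>G\<^esub> v"
    then have "c u \<in> C" "c v \<in> C" "c u \<noteq> c v" using assms(1,4) wf[OF uv] by auto
    then show "(h \<circ> c) u \<noteq> (h \<circ> c) v"
      using h by (auto simp: bij_betw_def inj_on_def)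
  qed
  then show ?thesis unfolding chromatic_number_def by (blast intro: Least_le)
qed

lemma out_degree_with_proj:
  "out_degree (with_proj G) v = card {w. (v, w) \<in> parcs G}"
proof -
  have "out_arcs (with_proj G) v = Pair v ` {w. (v, w) \<in> parcs G}"
    by (auto simp: out_arcs_def)
  then show ?thesis by (simp add: out_degree_def card_image inj_on_def)
qed

theorem theorem1p6:
  fixes f :: "nat \<Rightarrow> nat"
  assumes "\<And>n. n > 0 \<Longrightarrow> f n > 0"
    and "(\<lambda>n. real (f n)) \<in> o(\<lambda>n. real n)"
  shows "\<exists>N. \<forall>n\<ge>N. \<forall>G :: 'a pair_pre_digraph.
    pair_graph G \<and> card (pverts G) = n \<and> triangle_free G \<and>
    real (min_degree G) \<ge> 1 / 3 * real n - real (f n) \<and>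
    chromatic_number G \<ge> 10 ^ 391 \<longrightarrow>
    (\<exists>I1 I2 A.
       pverts G = I1 \<union> I2 \<union> A \<and> I1 \<inter> I2 = {} \<and> I1 \<inter> A = {} \<and> I2 \<inter> A = {} \<and>
       independent_set G I1 \<and> independent_set G I2 \<and>
       real (card I1) \<ge> 2 / 3 * real n - 9 * real (f n) \<and>
       real (card I2) \<ge> real n / 3 - 24 * real (f n) \<and>
       (\<exists>h. graph_hom (G \<restriction> A) (kneser_graph (nat \<lceil>real n / 3\<rceil> - 44 * f n) (97 * f n)) h))"
proof -
  have "\<forall>\<^sub>F n in sequentially. norm (real (f n)) \<le> 1 / 10000 * norm (real n)"
    by (rule landau_o.smallD[OF assms(2)]) simp
  then obtain N0 where N0: "\<And>n. n \<ge> N0 \<Longrightarrow> real (f n) \<le> real n / 10000"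
    by (auto simp: eventually_sequentially)
  show ?thesis
  \<comment> \<open>The maximum with 1 ensures that the graph has a vertex and that
    \<open>f n\<close> is positive.\<close>
  proof (intro exI[of _ "max N0 1"] allI impI, elim conjE)
    fix n :: nat and G :: "'a pair_pre_digraph"
    assume n: "max N0 1 \<le> n" and G: "pair_graph G" and card: "card (pverts G) = n"
      and tri: "triangle_free G"
      and mindeg: "real (min_degree G) \<ge> 1 / 3 * real n - real (f n)"
      and chi: "chromatic_number G \<ge> 10 ^ 391"
    interpret pair_graph G by (rule G)
    define N where "N v = {w. (v, w) \<in> parcs G}" for v
    have sym: "v \<in> N w" if "w \<in> N v" for v w
      using that by (simp add: N_def) (metis arcs_symmetric)
    have disj: "N v \<inter> N w = {}" if "w \<in> N v" for v w
    proof (rule ccontr)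
      assume "N v \<inter> N w \<noteq> {}"
      then obtain x where "x \<in> N v" "x \<in> N w" by auto
      then have "(v, w) \<in> parcs G" "(w, x) \<in> parcs G" "(x, v) \<in> parcs G"
        using that sym[of x v] by (simp_all add: N_def)
      with tri show False unfolding triangle_free_def with_proj_simps by blast
    qed
    have deg: "1 / 3 * real n - real (f n) \<le> real (card (N v))" if "v \<in> pverts G" for v
    proof -
      have "min_degree G \<le> out_degree G v"
        unfolding min_degree_def using that by (intro Min_le) auto
      then show ?thesis using mindeg by (simp add: out_degree_with_proj N_def)
    qed
    interpret D: dense_triangle_free "pverts G" N "real (f n)"
    proof
      show "finite (pverts G)" by simp
      show "pverts G \<noteq> {}" using n card by auto
      show "N v \<subseteq> pverts G" for v by (auto simp: N_def dest: in_arcsD2)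
      show "w \<in> N v \<Longrightarrow> v \<in> N w" for v w by (rule sym)
      show "w \<in> N v \<Longrightarrow> N v \<inter> N w = {}" for v w by (rule disj)
      show "v \<in> pverts G \<Longrightarrow> real (card (pverts G)) / 3 - real (f n) \<le> real (card (N v))" for v
        using deg[of v] card by simp
      show "real (f n) \<le> real (card (pverts G)) / 10000" using N0[of n] n card by simp
      show "real (f n) > 0" using assms(1)[of n] n by simp
    qed
    have wf: "u \<in> pverts G \<and> v \<in> pverts G \<and> v \<in> N u" if "u \<rightarrow>\<^bsub>G\<^esub> v" for u v
      using that by (auto simp: N_def dest: in_arcsD1 in_arcsD2)
    have no1: False if "c ` pverts G \<subseteq> pverts G" "card (c ` pverts G) \<le> 6 * 2 ^ 1200"
      "\<forall>v\<in>pverts G. \<forall>w\<in>N v. c v \<noteq> c w" for c :: "'a \<Rightarrow> 'a"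
    proof -
      have "chromatic_number G \<le> 6 * 2 ^ 1200"
        using that wf by (intro chromatic_number_le[of c _ "c ` pverts G"]) auto
      \<comment> \<open>The left side is about \<open>10 ^ 362\<close>.\<close>
      also have "\<dots> < 10 ^ 391" by simp
      finally show False using chi by (meson leD)
    qed
    have no2: False if "c ` pverts G \<subseteq> {..<7}"
      "\<forall>v\<in>pverts G. \<forall>w\<in>N v. c v \<noteq> c w" for c :: "'a \<Rightarrow> nat"
    proof -
      have "chromatic_number G \<le> 7"
        using that wf by (intro chromatic_number_le[of c _ "{..<7}"]) auto
      also have "\<dots> < 10 ^ 391" by simp
      finally show False using chi by (meson leD)
    qed
    obtain I J where I: "D.indep I" and J: "D.indep J" and IJ: "I \<inter> J = {}"
      and cI: "real (card I) \<ge> 2 / 3 * n - 8 * real (f n)" "real (card I) \<le> 2 / 3 * n + real (f n)"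
      and cJ: "real (card J) \<ge> n / 3 - 10 * real (f n)"
      and nb: "\<And>a. a \<in> pverts G - I \<Longrightarrow> real (card (N a \<inter> I)) \<ge> n / 3 - 10 * real (f n)"
      using D.colouring_or_partition[unfolded card] no1 no2 by (elim disjE exE conjE) metis+
    define A where "A = pverts G - I - J"
    define m where "m = nat \<lceil>real n / 3\<rceil> - 44 * f n"
    have f_small: "real (f n) \<le> real n / 10000" using N0[of n] n by simp
    \<comment> \<open>The natural subtraction in \<open>m\<close> does not truncate, because
      \<open>f n\<close> is at most \<open>n / 10000\<close>.\<close>
    have m: "real m = real_of_int \<lceil>real n / 3\<rceil> - 44 * real (f n)"
      using f_small unfolding m_def by linarith
    have ind: "independent_set G K" if "D.indep K" for K
      using that unfolding independent_set_def D.indep_def with_proj_simps by (auto simp: N_def)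
    have "\<exists>h. graph_hom (G \<restriction> A) (kneser_graph m (97 * f n)) h"
    proof (rule hom_to_kneser_graph[where T = "\<lambda>a. N a \<inter> I"])
      show "finite I" using I by (auto simp: D.indep_def intro: finite_subset)
      \<comment> \<open>\<open>2 * m + 97 * f n\<close> is at least
        \<open>2 / 3 * n + 9 * f n\<close>, whereas \<open>card I\<close> is at most
        \<open>2 / 3 * n + f n\<close>.\<close>
      show "card I \<le> 2 * m + 97 * f n" using cI(2) m by linarith
      show "N a \<inter> I \<subseteq> I \<and> m \<le> card (N a \<inter> I)" if "a \<in> verts (G \<restriction> A)" for a
      proof -
        have "a \<in> pverts G - I" using that by (auto simp: A_def)
        \<comment> \<open>Rounding up costs less than 1, and the bounds differ by
          \<open>34 * f n\<close>.\<close>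
        from nb[OF this] have "m \<le> card (N a \<inter> I)" using m by linarith
        then show ?thesis by simp
      qed
      show "a \<in> verts (G \<restriction> A) \<and> b \<in> verts (G \<restriction> A) \<and> N a \<inter> I \<inter> (N b \<inter> I) = {}"
        if "a \<rightarrow>\<^bsub>G \<restriction> A\<^esub> b" for a b
      proof -
        have "a \<in> A" "b \<in> A" "b \<in> N a"
          using that by (auto simp: induce_subgraph_def arcs_ends_def arc_to_ends_def N_def)
        then show ?thesis using disj[of b a] by (auto simp: induce_subgraph_def)
      qed
    qed
    moreover have "pverts G = I \<union> J \<union> A" "I \<inter> A = {}" "J \<inter> A = {}"
      using I J by (auto simp: A_def D.indep_def)
    ultimately show "\<exists>I1 I2 A.
       pverts G = I1 \<union> I2 \<union> A \<and> I1 \<inter> I2 = {} \<and> I1 \<inter> A = {} \<and> I2 \<inter> A = {} \<and>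
       independent_set G I1 \<and> independent_set G I2 \<and>
       real (card I1) \<ge> 2 / 3 * real n - 9 * real (f n) \<and>
       real (card I2) \<ge> real n / 3 - 24 * real (f n) \<and>
       (\<exists>h. graph_hom (G \<restriction> A) (kneser_graph (nat \<lceil>real n / 3\<rceil> - 44 * f n) (97 * f n)) h)"
      using IJ ind[OF I] ind[OF J] cI(1) cJ unfolding m_def
      by (intro exI[of _ I] exI[of _ J] exI[of _ A] conjI) auto
  qed
qed

end
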